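(* Let $f$ be a discrete Morse-Bott function on a Lefschetz complex $\mathbb{K}=(X,\dim,w)$, and let $\mu,\kappa\in\mathbb{K}$ with $w(\mu,\kappa)\neq0$. Assume that either (a) $f(\mu)<f(\kappa)$, or (b) $\mu$ and $\kappa$ are weakly critical for $f$ and $f(\mu)=f(\kappa)$. Then $f$ is a discrete Morse-Bott function on $\mathbb{K}\{\mu,\kappa\}$, $$P_t\bigl(\mathbb{K}\{\mu,\kappa\}\bigr)=P_t(\mathbb{K}),\qquad P_t\bigl(\mathbb{W}(\mathbb{K}\{\mu,\kappa\},f)\bigr)=P_t\bigl(\mathbb{W}(\mathbb{K},f)\bigr),$$ and consequently $R_t(\mathbb{K},f)=R_t(\mathbb{K}\{\mu,\kappa\},f)$.
   Context: A Lefschetz complex is a triple $\mathbb{K}=(X,\dim,w)$, where $X$ is a set (of cells), $\dim\colon X\to\mathbb{Z}_{\ge0}$ and $w\colon X\times X\to\mathbb{R}$ are functions, $\dim^{-1}(k)$ is finite for every $k$, and: (L1) $w(\tau,\sigma)\neq0$ implies $\dim\tau-\dim\sigma=1$; (L2) $\sum_{\sigma\in X}w(\tau,\sigma)w(\sigma,\nu)=0$ for all $\tau,\nu\in X$. A function on a complex is also regarded as a function on complexes with smaller cell set, by restriction. $C_k(\mathbb{K})$ is the real vector space with basis the $k$-cells (cells of dimension $k$), $C_{-1}(\mathbb{K})=\{0\}$, $\partial_k(\tau)=\sum_\sigma w(\tau,\sigma)\sigma$ for a $k$-cell $\tau$ (sum over $(k-1)$-cells), $B_k(\mathbb{K})=\operatorname{im}\partial_{k+1}$,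 $H_k(\mathbb{K})=\ker\partial_k/B_k(\mathbb{K})$, and $P_t(\mathbb{K})=\sum_{k\ge0}\operatorname{rank}H_k(\mathbb{K})\,t^k$. For $f\colon\mathbb{K}\to\mathbb{R}$ put $U^{\mathrm{snc}}(\sigma)=\#\{\tau\mid w(\tau,\sigma)\ne0,\ f(\sigma)>f(\tau)\}$, $D^{\mathrm{snc}}(\sigma)=\#\{\nu\mid w(\sigma,\nu)\ne0,\ f(\sigma)<f(\nu)\}$. $f$ is a discrete Morse-Bott function if $U^{\mathrm{snc}}(\sigma)\le1$ and $D^{\mathrm{snc}}(\sigma)\le1$ for all $\sigma$. A cell $\sigma$ is weakly critical if $U^{\mathrm{snc}}(\sigma)+D^{\mathrm{snc}}(\sigma)=0$. The weakly critical complex $\mathbb{W}(\mathbb{K},f)$ is the Lefschetz complex whose cells are the weakly critical cells, with the restricted dimension function and with incidence function equal to $w(\tau,\sigma)$ if $f(\tau)=f(\sigma)$ and $0$ otherwise. With $d_k^{\mathrm{snc}}(\mathbb{K},f)=\#\{k\text{-cells }\sigma\mid D^{\mathrm{snc}}(\sigma)=1\}$, $$R_t(\mathbb{K},f)=\sum_{k=1}^\infty\bigl(\operatorname{rank}B_{k-1}(\mathbb{K})-d_k^{\mathrm{snc}}(\mathbb{K},f)-\operatorname{rank}B_{k-1}(\mathbb{W}(\mathbb{K},f))\bigr)t^{k-1}.$$ For $\mu,\kappa\in\mathbb{K}$ with $w(\mu,\kappa)\ne0$, $\mathbb{K}\{\mu,\kappa\}$ is the Lefschetz complex with cell set $X\setminus\{\mu,\kappa\}$,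 restricted dimension function, and incidence function $w'(\tau,\sigma)=w(\tau,\sigma)-\dfrac{w(\tau,\kappa)w(\mu,\sigma)}{w(\mu,\kappa)}$. *)

theory Defs
  imports
    "HOL-Algebra.AbelCoset"
    "Jordan_Normal_Form.VS_Connect"
    "HOL-Computational_Algebra.Formal_Power_Series"
begin

hide_const (open) Multiset.mult

section \<open>Lefschetz complexes\<close>

text \<open>
  The fields of the record are total functions on the type of cells; only their values on
  \<open>cells K\<close> are meaningful, and every definition below restricts to \<open>cells K\<close>. In the same way
  a function \<open>f\<close> on cells is a function on every complex over the type, so restriction
  of \<open>f\<close> to a smaller cell set is silent.
\<close>

record 'a lefschetz =
  cells :: "'a set"
  cdim :: "'a \<Rightarrow> nat"
  inc :: "'a \<Rightarrow> 'a \<Rightarrow> real"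

text \<open>
  The cell set may be infinite, so the sum in \<open>L2\<close> runs over the cells with nonzero first
  factor; there are finitely many of them by \<open>L1\<close> and \<open>finite_dim_cells\<close>.
\<close>

locale lefschetz_complex =
  fixes K :: "'a lefschetz"
  assumes finite_dim_cells: "\<And>k. finite {\<sigma> \<in> cells K. cdim K \<sigma> = k}"
    and L1: "\<And>\<tau> \<sigma>. \<tau> \<in> cells K \<Longrightarrow> \<sigma> \<in> cells K \<Longrightarrow> inc K \<tau> \<sigma> \<noteq> 0 \<Longrightarrow>
               int (cdim K \<tau>) - int (cdim K \<sigma>) = 1"
    and L2: "\<And>\<tau> \<nu>. \<tau> \<in> cells K \<Longrightarrow> \<nu> \<in> cells K \<Longrightarrow>
               (\<Sum>\<sigma> \<in> {\<sigma> \<in> cells K. inc K \<tau> \<sigma> \<noteq> 0}. inc K \<tau> \<sigma> * inc K \<sigma> \<nu>) = 0"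

definition cancel_pair :: "'a lefschetz \<Rightarrow> 'a \<Rightarrow> 'a \<Rightarrow> 'a lefschetz" where
  "cancel_pair K \<mu> \<kappa> =
     \<lparr> cells = cells K - {\<mu>, \<kappa>},
       cdim = cdim K,
       inc = (\<lambda>\<tau> \<sigma>. inc K \<tau> \<sigma> - inc K \<tau> \<kappa> * inc K \<mu> \<sigma> / inc K \<mu> \<kappa>) \<rparr>"


section \<open>Chains and homology\<close>

text \<open>
  Degrees are integers, so that degree \<open>-1\<close> has no cells and its chain space is zero.
\<close>

definition dim_cells :: "'a lefschetz \<Rightarrow> int \<Rightarrow> 'a set" where
  "dim_cells K k = {\<sigma> \<in> cells K. int (cdim K \<sigma>) = k}"

text \<open>
  A chain is given by its coefficients: as there are finitely many \<open>k\<close>-cells, the vector space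
  with basis the \<open>k\<close>-cells is the space of all real functions on them.
\<close>

definition chain_space :: "'a lefschetz \<Rightarrow> int \<Rightarrow> (real, 'a \<Rightarrow> real) module" where
  "chain_space K k = ring.func_space class_ring (dim_cells K k)"

definition boundary :: "'a lefschetz \<Rightarrow> int \<Rightarrow> ('a \<Rightarrow> real) \<Rightarrow> ('a \<Rightarrow> real)" where
  "boundary K k c =
     (\<lambda>\<sigma> \<in> dim_cells K (k - 1). \<Sum>\<tau> \<in> dim_cells K k. c \<tau> * inc K \<tau> \<sigma>)"

definition cycles :: "'a lefschetz \<Rightarrow> int \<Rightarrow> ('a \<Rightarrow> real) set" where
  "cycles K k = a_kernel (chain_space K k) (chain_space K (k - 1)) (boundary K k)"

definition boundaries :: "'a lefschetz \<Rightarrow> int \<Rightarrow> ('a \<Rightarrow> real) set" where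
  "boundaries K k = boundary K (k + 1) ` carrier (chain_space K (k + 1))"

text \<open>
  The quotient \<open>V / W\<close> of a module by a submodule, on the set of cosets of \<open>W\<close>. The fields
  \<open>mult\<close> and \<open>one\<close> come with the record type of modules and carry no meaning.
\<close>

definition quotient_space ::
    "('r, 'v, 'm) module_scheme \<Rightarrow> 'v set \<Rightarrow> ('r, 'v set) module" where
  "quotient_space V W =
     \<lparr> carrier = a_rcosets\<^bsub>V\<^esub> W,
       mult = (\<lambda>A B. W), one = W,
       zero = W, add = set_add V,
       smult = (\<lambda>r A. \<Union>v\<in>A. W +>\<^bsub>V\<^esub> (r \<odot>\<^bsub>V\<^esub> v)) \<rparr>"

definition homology :: "'a lefschetz \<Rightarrow> int \<Rightarrow> (real, ('a \<Rightarrow> real) set) module" where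
  "homology K k = quotient_space ((chain_space K k)\<lparr>carrier := cycles K k\<rparr>) (boundaries K k)"

definition rank_homology :: "'a lefschetz \<Rightarrow> int \<Rightarrow> nat" where
  "rank_homology K k = vectorspace.dim class_ring (homology K k)"

definition rank_boundaries :: "'a lefschetz \<Rightarrow> int \<Rightarrow> nat" where
  "rank_boundaries K k =
     vectorspace.dim class_ring ((chain_space K k)\<lparr>carrier := boundaries K k\<rparr>)"

definition poincare_series :: "'a lefschetz \<Rightarrow> int fps" where
  "poincare_series K = Abs_fps (\<lambda>k. int (rank_homology K (int k)))"


section \<open>Discrete Morse--Bott functions\<close>

definition up_snc :: "'a lefschetz \<Rightarrow> ('a \<Rightarrow> real) \<Rightarrow> 'a \<Rightarrow> nat" where
  "up_snc K f \<sigma> = card {\<tau> \<in> cells K. inc K \<tau> \<sigma> \<noteq> 0 \<and> f \<sigma> > f \<tau>}"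

definition down_snc :: "'a lefschetz \<Rightarrow> ('a \<Rightarrow> real) \<Rightarrow> 'a \<Rightarrow> nat" where
  "down_snc K f \<sigma> = card {\<nu> \<in> cells K. inc K \<sigma> \<nu> \<noteq> 0 \<and> f \<sigma> < f \<nu>}"

definition discrete_morse_bott :: "'a lefschetz \<Rightarrow> ('a \<Rightarrow> real) \<Rightarrow> bool" where
  "discrete_morse_bott K f \<longleftrightarrow> (\<forall>\<sigma> \<in> cells K. up_snc K f \<sigma> \<le> 1 \<and> down_snc K f \<sigma> \<le> 1)"

definition weakly_critical :: "'a lefschetz \<Rightarrow> ('a \<Rightarrow> real) \<Rightarrow> 'a \<Rightarrow> bool" where
  "weakly_critical K f \<sigma> \<longleftrightarrow> \<sigma> \<in> cells K \<and> up_snc K f \<sigma> + down_snc K f \<sigma> = 0"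

definition wc_complex :: "'a lefschetz \<Rightarrow> ('a \<Rightarrow> real) \<Rightarrow> 'a lefschetz" where
  "wc_complex K f =
     \<lparr> cells = {\<sigma>. weakly_critical K f \<sigma>},
       cdim = cdim K,
       inc = (\<lambda>\<tau> \<sigma>. if f \<tau> = f \<sigma> then inc K \<tau> \<sigma> else 0) \<rparr>"

definition d_snc :: "'a lefschetz \<Rightarrow> ('a \<Rightarrow> real) \<Rightarrow> int \<Rightarrow> nat" where
  "d_snc K f k = card {\<sigma> \<in> dim_cells K k. down_snc K f \<sigma> = 1}"

text \<open>
  The series \<open>R\<close>, the sum over \<open>k \<ge> 1\<close> of terms in degree \<open>k - 1\<close>, indexed by \<open>n = k - 1\<close>.
\<close>

definition remainder_series :: "'a lefschetz \<Rightarrow> ('a \<Rightarrow> real) \<Rightarrow> int fps" where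
  "remainder_series K f =
     Abs_fps (\<lambda>n. int (rank_boundaries K (int n)) - int (d_snc K f (int n + 1))
                  - int (rank_boundaries (wc_complex K f) (int n)))"


section \<open>The derived complexes are Lefschetz complexes\<close>

lemma cancel_pair_simps:
  "cells (cancel_pair K \<mu> \<kappa>) = cells K - {\<mu>, \<kappa>}"
  "cdim (cancel_pair K \<mu> \<kappa>) = cdim K"
  "inc (cancel_pair K \<mu> \<kappa>) \<tau> \<sigma> = inc K \<tau> \<sigma> - inc K \<tau> \<kappa> * inc K \<mu> \<sigma> / inc K \<mu> \<kappa>"
  by (simp_all add: cancel_pair_def)

lemma wc_complex_simps:
  "cells (wc_complex K f) = {\<sigma>. weakly_critical K f \<sigma>}"
  "cdim (wc_complex K f) = cdim K"
  "inc (wc_complex K f) \<tau> \<sigma> = (if f \<tau> = f \<sigma> then inc K \<tau> \<sigma> else 0)"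
  by (simp_all add: wc_complex_def)

context lefschetz_complex
begin

lemma finite_dim_cells': "finite (dim_cells K k)"
  by (rule finite_subset[OF _ finite_dim_cells[of "nat k"]]) (auto simp: dim_cells_def)

lemma L2_sum:
  assumes "\<tau> \<in> cells K" "\<nu> \<in> cells K" "finite S" "S \<subseteq> cells K"
    and "\<And>\<sigma>. \<sigma> \<in> cells K \<Longrightarrow> inc K \<tau> \<sigma> \<noteq> 0 \<Longrightarrow> inc K \<sigma> \<nu> \<noteq> 0 \<Longrightarrow> \<sigma> \<in> S"
  shows "(\<Sum>\<sigma>\<in>S. inc K \<tau> \<sigma> * inc K \<sigma> \<nu>) = 0"
proof -
  have fin: "finite {\<sigma> \<in> cells K. inc K \<tau> \<sigma> \<noteq> 0}"
    by (rule finite_subset[OF _ finite_dim_cells[of "cdim K \<tau> - 1"]])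
      (use L1[OF assms(1)] in fastforce)
  have "(\<Sum>\<sigma>\<in>S. inc K \<tau> \<sigma> * inc K \<sigma> \<nu>)
      = (\<Sum>\<sigma> \<in> {\<sigma> \<in> cells K. inc K \<tau> \<sigma> \<noteq> 0}. inc K \<tau> \<sigma> * inc K \<sigma> \<nu>)"
    by (rule sum.mono_neutral_cong) (use assms fin in auto)
  then show ?thesis using L2[OF assms(1,2)] by simp
qed

lemma lefschetz_complex_cancel_pair:
  assumes mu: "\<mu> \<in> cells K" and ka: "\<kappa> \<in> cells K" and nz: "inc K \<mu> \<kappa> \<noteq> 0"
  shows "lefschetz_complex (cancel_pair K \<mu> \<kappa>)"
proof
  fix k show "finite {\<sigma> \<in> cells (cancel_pair K \<mu> \<kappa>). cdim (cancel_pair K \<mu> \<kappa>) \<sigma> = k}"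
    by (rule finite_subset[OF _ finite_dim_cells[of k]]) (auto simp: cancel_pair_simps)
next
  fix \<tau> \<sigma> assume "\<tau> \<in> cells (cancel_pair K \<mu> \<kappa>)" "\<sigma> \<in> cells (cancel_pair K \<mu> \<kappa>)"
    "inc (cancel_pair K \<mu> \<kappa>) \<tau> \<sigma> \<noteq> 0"
  then have "\<tau> \<in> cells K" "\<sigma> \<in> cells K"
    "inc K \<tau> \<sigma> \<noteq> 0 \<or> (inc K \<tau> \<kappa> \<noteq> 0 \<and> inc K \<mu> \<sigma> \<noteq> 0)"
    by (auto simp: cancel_pair_simps)
  then show "int (cdim (cancel_pair K \<mu> \<kappa>) \<tau>) - int (cdim (cancel_pair K \<mu> \<kappa>) \<sigma>) = 1"
    using L1[of \<tau> \<sigma>] L1[of \<tau> \<kappa>] L1[of \<mu> \<sigma>] L1[of \<mu> \<kappa>] mu ka nz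
    by (auto simp: cancel_pair_simps)
next
  fix \<tau> \<nu> assume "\<tau> \<in> cells (cancel_pair K \<mu> \<kappa>)" "\<nu> \<in> cells (cancel_pair K \<mu> \<kappa>)"
  then have t: "\<tau> \<in> cells K" "\<tau> \<noteq> \<mu>" "\<tau> \<noteq> \<kappa>" and n: "\<nu> \<in> cells K" "\<nu> \<noteq> \<mu>" "\<nu> \<noteq> \<kappa>"
    by (auto simp: cancel_pair_simps)
  define w where "w = inc K"
  define w' where "w' = inc (cancel_pair K \<mu> \<kappa>)"
  define T where "T = {\<sigma> \<in> cells K. cdim K \<sigma> \<le> cdim K \<tau> + cdim K \<mu>}"
  have w': "w' a b = w a b - w a \<kappa> * w \<mu> b / w \<mu> \<kappa>" for a b
    by (simp add: w'_def w_def cancel_pair_simps)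
  have nz': "w \<mu> \<kappa> \<noteq> 0" using nz by (simp add: w_def)
  have "T = (\<Union>k\<le>cdim K \<tau> + cdim K \<mu>. {\<sigma> \<in> cells K. cdim K \<sigma> = k})"
    by (auto simp: T_def)
  then have finT: "finite T" using finite_dim_cells by simp
  have TK: "T \<subseteq> cells K" by (auto simp: T_def)
  have Z: "(\<Sum>\<sigma>\<in>T. w a \<sigma> * w \<sigma> b) = 0" if "a \<in> {\<tau>, \<mu>}" "b \<in> cells K" for a b
    unfolding w_def
    by (rule L2_sum[OF _ that(2) finT TK]) (use that t mu L1 in \<open>fastforce simp: T_def\<close>)+
  have "(\<Sum>\<sigma>\<in>T. w' \<tau> \<sigma> * w' \<sigma> \<nu>)
     = (\<Sum>\<sigma>\<in>T. w \<tau> \<sigma> * w \<sigma> \<nu>) - (\<Sum>\<sigma>\<in>T. w \<tau> \<sigma> * w \<sigma> \<kappa>) * (w \<mu> \<nu> / w \<mu> \<kappa>)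
       - (\<Sum>\<sigma>\<in>T. w \<mu> \<sigma> * w \<sigma> \<nu>) * (w \<tau> \<kappa> / w \<mu> \<kappa>)
       + (\<Sum>\<sigma>\<in>T. w \<mu> \<sigma> * w \<sigma> \<kappa>) * (w \<tau> \<kappa> / w \<mu> \<kappa> * (w \<mu> \<nu> / w \<mu> \<kappa>))"
    unfolding sum_distrib_right sum.distrib[symmetric] sum_subtractf[symmetric]
    by (rule sum.cong) (auto simp: w' algebra_simps)
  also have "\<dots> = 0" using Z[of \<tau> \<nu>] Z[of \<tau> \<kappa>] Z[of \<mu> \<nu>] Z[of \<mu> \<kappa>] n ka by simp
  finally have 0: "(\<Sum>\<sigma>\<in>T. w' \<tau> \<sigma> * w' \<sigma> \<nu>) = 0" .
  have "w' \<tau> \<kappa> = 0" "w' \<mu> \<nu> = 0" using nz' by (auto simp: w')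
  then have "(\<Sum>\<sigma>\<in>{\<sigma> \<in> cells (cancel_pair K \<mu> \<kappa>). w' \<tau> \<sigma> \<noteq> 0}. w' \<tau> \<sigma> * w' \<sigma> \<nu>)
      = (\<Sum>\<sigma>\<in>T. w' \<tau> \<sigma> * w' \<sigma> \<nu>)"
  proof (intro sum.mono_neutral_cong_left[OF finT])
    show "{\<sigma> \<in> cells (cancel_pair K \<mu> \<kappa>). w' \<tau> \<sigma> \<noteq> 0} \<subseteq> T"
    proof
      fix \<sigma> assume "\<sigma> \<in> {\<sigma> \<in> cells (cancel_pair K \<mu> \<kappa>). w' \<tau> \<sigma> \<noteq> 0}"
      then have "\<sigma> \<in> cells K" "w \<tau> \<sigma> \<noteq> 0 \<or> w \<mu> \<sigma> \<noteq> 0"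
        by (auto simp: cancel_pair_simps w')
      then show "\<sigma> \<in> T" using L1[of \<tau> \<sigma>] L1[of \<mu> \<sigma>] t mu by (auto simp: T_def w_def)
    qed
  qed (auto simp: T_def cancel_pair_simps)
  with 0 show "(\<Sum>\<sigma>\<in>{\<sigma> \<in> cells (cancel_pair K \<mu> \<kappa>). inc (cancel_pair K \<mu> \<kappa>) \<tau> \<sigma> \<noteq> 0}.
      inc (cancel_pair K \<mu> \<kappa>) \<tau> \<sigma> * inc (cancel_pair K \<mu> \<kappa>) \<sigma> \<nu>) = 0"
    by (simp add: w'_def)
qed

lemma finite_up: "\<sigma> \<in> cells K \<Longrightarrow> finite {\<tau> \<in> cells K. inc K \<tau> \<sigma> \<noteq> 0 \<and> P \<tau>}"
  by (rule finite_subset[OF _ finite_dim_cells[of "cdim K \<sigma> + 1"]]) (use L1 in fastforce)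

lemma finite_down: "\<sigma> \<in> cells K \<Longrightarrow> finite {\<nu> \<in> cells K. inc K \<sigma> \<nu> \<noteq> 0 \<and> P \<nu>}"
  by (rule finite_subset[OF _ finite_dim_cells[of "cdim K \<sigma> - 1"]]) (use L1 in fastforce)

lemma weakly_critical_iff:
  "weakly_critical K f \<sigma> \<longleftrightarrow> \<sigma> \<in> cells K
     \<and> (\<forall>\<tau>\<in>cells K. inc K \<tau> \<sigma> \<noteq> 0 \<longrightarrow> f \<sigma> \<le> f \<tau>)
     \<and> (\<forall>\<nu>\<in>cells K. inc K \<sigma> \<nu> \<noteq> 0 \<longrightarrow> f \<nu> \<le> f \<sigma>)"
  using finite_up[of \<sigma> "\<lambda>\<tau>. f \<sigma> > f \<tau>"] finite_down[of \<sigma> "\<lambda>\<nu>. f \<sigma> < f \<nu>"]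
  by (auto simp: weakly_critical_def up_snc_def down_snc_def not_less)

lemma L2_other:
  assumes "\<tau> \<in> cells K" "\<nu> \<in> cells K" "\<sigma> \<in> cells K" "inc K \<tau> \<sigma> \<noteq> 0" "inc K \<sigma> \<nu> \<noteq> 0"
  obtains \<sigma>' where "\<sigma>' \<in> cells K" "\<sigma>' \<noteq> \<sigma>" "inc K \<tau> \<sigma>' \<noteq> 0" "inc K \<sigma>' \<nu> \<noteq> 0"
proof (rule ccontr)
  assume "\<not> thesis"
  with that have "(\<Sum>\<sigma>'\<in>{\<sigma>}. inc K \<tau> \<sigma>' * inc K \<sigma>' \<nu>) = 0"
    using assms(3) by (intro L2_sum[OF assms(1,2)]) auto
  then show False using assms by simp
qed

lemma lefschetz_complex_wc_complex:
  assumes mb: "discrete_morse_bott K f"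
  shows "lefschetz_complex (wc_complex K f)"
proof
  fix k show "finite {\<sigma> \<in> cells (wc_complex K f). cdim (wc_complex K f) \<sigma> = k}"
    by (rule finite_subset[OF _ finite_dim_cells[of k]])
      (auto simp: wc_complex_simps weakly_critical_def)
next
  fix \<tau> \<sigma> assume "\<tau> \<in> cells (wc_complex K f)" "\<sigma> \<in> cells (wc_complex K f)"
    "inc (wc_complex K f) \<tau> \<sigma> \<noteq> 0"
  then show "int (cdim (wc_complex K f) \<tau>) - int (cdim (wc_complex K f) \<sigma>) = 1"
    using L1[of \<tau> \<sigma>] by (auto simp: wc_complex_simps weakly_critical_def split: if_splits)
next
  fix \<tau> \<nu> assume "\<tau> \<in> cells (wc_complex K f)" "\<nu> \<in> cells (wc_complex K f)"
  then have t: "\<tau> \<in> cells K" and n: "\<nu> \<in> cells K"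
    and wt: "\<And>\<sigma>. \<sigma> \<in> cells K \<Longrightarrow> inc K \<tau> \<sigma> \<noteq> 0 \<Longrightarrow> f \<sigma> \<le> f \<tau>"
    and wn: "\<And>\<sigma>. \<sigma> \<in> cells K \<Longrightarrow> inc K \<sigma> \<nu> \<noteq> 0 \<Longrightarrow> f \<nu> \<le> f \<sigma>"
    by (auto simp: wc_complex_simps weakly_critical_iff)
  define S where "S = {\<sigma> \<in> cells (wc_complex K f). inc (wc_complex K f) \<tau> \<sigma> \<noteq> 0}"
  have finS: "finite S" and SK: "S \<subseteq> cells K"
    using finite_down[OF t, of "\<lambda>_. True"]
    by (auto simp: S_def wc_complex_simps weakly_critical_def elim!: rev_finite_subset split: if_splits)
  show "(\<Sum>\<sigma> \<in> S. inc (wc_complex K f) \<tau> \<sigma> * inc (wc_complex K f) \<sigma> \<nu>) = 0"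
  proof (cases "f \<tau> = f \<nu>")
    case False
    then show ?thesis by (auto intro!: sum.neutral simp: wc_complex_simps)
  next
    case True
    have crit: "weakly_critical K f \<sigma> \<and> f \<sigma> = f \<tau>"
      if s: "\<sigma> \<in> cells K" and ts: "inc K \<tau> \<sigma> \<noteq> 0" and sn: "inc K \<sigma> \<nu> \<noteq> 0" for \<sigma>
    proof -
      have fs: "f \<sigma> = f \<tau>" using wt[OF s ts] wn[OF s sn] True by simp
      have up: "f \<sigma> \<le> f \<tau>'" if t': "\<tau>' \<in> cells K" "inc K \<tau>' \<sigma> \<noteq> 0" for \<tau>'
      proof (rule ccontr)
        assume less: "\<not> f \<sigma> \<le> f \<tau>'"
        obtain \<sigma>' where s': "\<sigma>' \<in> cells K" "\<sigma>' \<noteq> \<sigma>" "inc K \<tau>' \<sigma>' \<noteq> 0" "inc K \<sigma>' \<nu> \<noteq> 0"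
          using L2_other[OF t'(1) n s t'(2) sn] by metis
        then have "{\<sigma>, \<sigma>'} \<subseteq> {\<nu> \<in> cells K. inc K \<tau>' \<nu> \<noteq> 0 \<and> f \<tau>' < f \<nu>}"
          using s t' less wn[OF s'(1,4)] fs True by auto
        from card_mono[OF finite_down[OF t'(1)] this] s'(2) have "2 \<le> down_snc K f \<tau>'"
          by (simp add: down_snc_def)
        with mb t'(1) show False unfolding discrete_morse_bott_def by fastforce
      qed
      have down: "f \<nu>' \<le> f \<sigma>" if n': "\<nu>' \<in> cells K" "inc K \<sigma> \<nu>' \<noteq> 0" for \<nu>'
      proof (rule ccontr)
        assume less: "\<not> f \<nu>' \<le> f \<sigma>"
        obtain \<sigma>' where s': "\<sigma>' \<in> cells K" "\<sigma>' \<noteq> \<sigma>" "inc K \<tau> \<sigma>' \<noteq> 0" "inc K \<sigma>' \<nu>' \<noteq> 0"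
          using L2_other[OF t n'(1) s ts n'(2)] by metis
        then have "{\<sigma>, \<sigma>'} \<subseteq> {\<tau> \<in> cells K. inc K \<tau> \<nu>' \<noteq> 0 \<and> f \<nu>' > f \<tau>}"
          using s n' less wt[OF s'(1,3)] fs by auto
        from card_mono[OF finite_up[OF n'(1)] this] s'(2) have "2 \<le> up_snc K f \<nu>'"
          by (simp add: up_snc_def)
        with mb n'(1) show False unfolding discrete_morse_bott_def by fastforce
      qed
      show ?thesis using up down fs s by (auto simp: weakly_critical_iff)
    qed
    have "(\<Sum>\<sigma> \<in> S. inc (wc_complex K f) \<tau> \<sigma> * inc (wc_complex K f) \<sigma> \<nu>)
        = (\<Sum>\<sigma> \<in> S. inc K \<tau> \<sigma> * inc K \<sigma> \<nu>)"
      by (rule sum.cong) (auto simp: S_def wc_complex_simps True split: if_splits)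
    also have "\<dots> = 0"
      by (rule L2_sum[OF t n finS SK]) (use crit in \<open>auto simp: S_def wc_complex_simps\<close>)
    finally show ?thesis .
  qed
qed

end

end

theory Submission
  imports Defs
begin

text \<open>
  Write \<open>K'\<close> for \<open>cancel_pair K \<mu> \<kappa>\<close> and \<open>W(K)\<close> for \<open>wc_complex K f\<close>.

  \<^bold>\<open>Homology.\<close> The chains \<open>\<mu>\<close> and \<open>\<partial>\<mu>\<close> span a subcomplex without homology, and the incidence function
  of \<open>K'\<close> is that of the quotient by it: sending a chain \<open>c\<close> to \<open>c - (c \<kappa> / w \<mu> \<kappa>) \<partial>\<mu>\<close>, which has
  no \<open>\<kappa>\<close>-component, and forgetting the \<open>\<mu>\<close>-component is a surjective chain map
  (\<open>boundary_cancel_chain\<close>, \<open>cancel_chain_image\<close>). Among the boundaries of degree \<open>k\<close> its kernel is the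
  line spanned by \<open>\<partial>\<mu>\<close> if \<open>k = dim \<kappa>\<close>, and zero otherwise (\<open>cancel_chain_kernel\<close>). So the only rank
  of boundaries that changes is the one in degree \<open>dim \<kappa>\<close>, which drops by one
  (\<open>rank_boundaries_cancel_pair\<close>). By rank-nullity, in every Lefschetz complex
  \<open>rank H_k + rank B_k + rank B_{k-1}\<close> is the number of \<open>k\<close>-cells (\<open>rank_homology_eq\<close>). In degrees
  \<open>dim \<kappa>\<close> and \<open>dim \<mu> = dim \<kappa> + 1\<close> one boundary rank and the number of cells both drop by one, so the
  ranks of homology do not change.

  \<^bold>\<open>Morse--Bott data.\<close> The incidence of \<open>\<tau>\<close> and \<open>\<sigma>\<close> changes only if \<open>w \<tau> \<kappa>\<close> and \<open>w \<mu> \<sigma>\<close> are both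
  nonzero, and then the hypotheses force \<open>f \<sigma> \<le> f \<mu> \<le> f \<kappa> \<le> f \<tau>\<close>. Incidences with \<open>f \<tau> < f \<sigma>\<close>, the
  only ones that are counted by \<open>U\<close> and \<open>D\<close>, are therefore untouched. Moreover neither \<open>\<mu>\<close> nor \<open>\<kappa>\<close>
  is counted at any other cell (\<open>pair_notin_up\<close>, \<open>pair_notin_down\<close>). Hence \<open>U\<close> and \<open>D\<close> are the same
  for \<open>K'\<close> as for \<open>K\<close>, and the weakly critical cells of \<open>K'\<close> are those of \<open>K\<close> other than \<open>\<mu>\<close> and
  \<open>\<kappa>\<close>.

  If \<open>f \<mu> < f \<kappa>\<close>, then \<open>\<mu>\<close> and \<open>\<kappa>\<close> are not weakly critical, the displayed chain is strict in the
  middle, and \<open>W(K')\<close> agrees with \<open>W(K)\<close>. If \<open>f \<mu> = f \<kappa>\<close>, then \<open>W(K')\<close> agrees with the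
  complex obtained from \<open>W(K)\<close> by cancelling \<open>\<mu>\<close> and \<open>\<kappa>\<close>, to which the first part applies. In the
  remainder series, the drop of \<open>rank B_{dim \<kappa>}\<close> is compensated by the loss of \<open>\<mu>\<close> in \<open>d_{dim \<mu>}\<close> in
  the first case, and by the drop of \<open>rank B_{dim \<kappa>}\<close> of the weakly critical complex in the second.
\<close>

section \<open>Dimensions of quotients and function spaces\<close>

lemma linear_mapI:
  assumes "vectorspace K V" "vectorspace K W"
    and "\<And>v. v \<in> carrier V \<Longrightarrow> T v \<in> carrier W"
    and "\<And>v w. v \<in> carrier V \<Longrightarrow> w \<in> carrier V \<Longrightarrow> T (v \<oplus>\<^bsub>V\<^esub> w) = T v \<oplus>\<^bsub>W\<^esub> T w"
    and "\<And>c v. c \<in> carrier K \<Longrightarrow> v \<in> carrier V \<Longrightarrow> T (c \<odot>\<^bsub>V\<^esub> v) = c \<odot>\<^bsub>W\<^esub> T v"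
  shows "linear_map K V W T"
  using assms by (auto simp: linear_map_def mod_hom_def mod_hom_axioms_def
      LinearCombinations.module_hom_def vectorspace_def)

text \<open>
  The equational axioms of a vector space pass from \<open>V\<close> to \<open>Q\<close> because every vector of \<open>Q\<close> is a value
  of \<open>T\<close>, and \<open>T (- v)\<close> is a negative of \<open>T v\<close>. Quotients and spaces of boundaries are recognised as
  vector spaces in this way.
\<close>

lemma linear_map_onto_imageI:
  assumes V: "vectorspace K V"
    and carrier: "carrier Q = T ` carrier V"
    and zero: "\<zero>\<^bsub>Q\<^esub> = T \<zero>\<^bsub>V\<^esub>"
    and add: "\<And>v w. v \<in> carrier V \<Longrightarrow> w \<in> carrier V \<Longrightarrow> T (v \<oplus>\<^bsub>V\<^esub> w) = T v \<oplus>\<^bsub>Q\<^esub> T w"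
    and smult: "\<And>c v. c \<in> carrier K \<Longrightarrow> v \<in> carrier V \<Longrightarrow> T (c \<odot>\<^bsub>V\<^esub> v) = c \<odot>\<^bsub>Q\<^esub> T v"
  shows "linear_map K V Q T"
proof -
  interpret V: vectorspace K V by (rule V)
  have "vectorspace K Q"
  proof (rule vs_criteria[OF V.field_axioms])
    show "\<forall>v\<in>carrier Q. \<exists>w\<in>carrier Q. v \<oplus>\<^bsub>Q\<^esub> w = \<zero>\<^bsub>Q\<^esub>"
    proof
      fix v assume "v \<in> carrier Q"
      then obtain u where "u \<in> carrier V" "v = T u" by (auto simp: carrier)
      then show "\<exists>w\<in>carrier Q. v \<oplus>\<^bsub>Q\<^esub> w = \<zero>\<^bsub>Q\<^esub>"
        by (intro bexI[of _ "T (\<ominus>\<^bsub>V\<^esub> u)"])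
          (auto simp: carrier zero add[symmetric] V.r_neg)
    qed
  qed (auto simp: carrier zero add[symmetric] smult[symmetric] V.a_ac
      V.smult_assoc1 V.smult_l_distr V.smult_r_distr)
  then show ?thesis
    by (intro linear_mapI[OF V]) (simp_all add: carrier add smult)
qed

lemma (in Module.module) subgroup_submodule:
  assumes W: "submodule R W M"
  shows "subgroup W (add_monoid M)"
proof -
  interpret W: submodule R W M by (rule W)
  show ?thesis
  proof
    fix x assume x: "x \<in> W"
    then have "\<ominus>\<^bsub>M\<^esub> x = (\<ominus>\<^bsub>R\<^esub> \<one>\<^bsub>R\<^esub>) \<odot>\<^bsub>M\<^esub> x"
      using W.subset by (auto simp: smult_minus_1)
    then show "inv\<^bsub>add_monoid M\<^esub> x \<in> W"
      using x by (auto simp: a_inv_def[symmetric])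
  qed (use W.subset in auto)
qed

text \<open>
  The content is that the scalar multiplication of the quotient, a union over all representatives, is a
  union of equal cosets.
\<close>

lemma (in vectorspace) linear_map_coset:
  assumes W: "submodule K W V"
  shows "linear_map K V (quotient_space V W) (\<lambda>v. W +>\<^bsub>V\<^esub> v)"
proof -
  interpret W: submodule K W V by (rule W)
  interpret A: abelian_subgroup W V
    using subgroup_submodule[OF W] by (intro abelian_subgroupI3) (auto simp: additive_subgroup_def M.abelian_group_axioms)
  show ?thesis
  proof (rule linear_map_onto_imageI[OF vectorspace_axioms])
    show "carrier (quotient_space V W) = (\<lambda>v. W +>\<^bsub>V\<^esub> v) ` carrier V"
      by (auto simp: quotient_space_def A_RCOSETS_def')
    show "\<zero>\<^bsub>quotient_space V W\<^esub> = W +>\<^bsub>V\<^esub> \<zero>\<^bsub>V\<^esub>"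
      using W.subset by (simp add: quotient_space_def)
    show "W +>\<^bsub>V\<^esub> (v \<oplus>\<^bsub>V\<^esub> w) = (W +>\<^bsub>V\<^esub> v) \<oplus>\<^bsub>quotient_space V W\<^esub> (W +>\<^bsub>V\<^esub> w)"
      if "v \<in> carrier V" "w \<in> carrier V" for v w
      using that by (simp add: quotient_space_def A.a_rcos_sum)
    show "W +>\<^bsub>V\<^esub> (c \<odot>\<^bsub>V\<^esub> v) = c \<odot>\<^bsub>quotient_space V W\<^esub> (W +>\<^bsub>V\<^esub> v)"
      if c: "c \<in> carrier K" and v: "v \<in> carrier V" for c v
    proof -
      have "W +>\<^bsub>V\<^esub> (c \<odot>\<^bsub>V\<^esub> u) = W +>\<^bsub>V\<^esub> (c \<odot>\<^bsub>V\<^esub> v)" if u: "u \<in> W +>\<^bsub>V\<^esub> v" for u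
      proof -
        obtain w where w: "w \<in> W" "u = w \<oplus>\<^bsub>V\<^esub> v" using u by (auto simp: a_r_coset_def')
        then have "c \<odot>\<^bsub>V\<^esub> u = (c \<odot>\<^bsub>V\<^esub> w) \<oplus>\<^bsub>V\<^esub> (c \<odot>\<^bsub>V\<^esub> v)"
          using c v W.subset by (auto simp: smult_r_distr)
        then have "c \<odot>\<^bsub>V\<^esub> u \<in> W +>\<^bsub>V\<^esub> (c \<odot>\<^bsub>V\<^esub> v)"
          using w c by (auto simp: a_r_coset_def')
        then show ?thesis using A.a_repr_independence'[of _ "c \<odot>\<^bsub>V\<^esub> v"] c v by simp
      qed
      moreover have "v \<in> W +>\<^bsub>V\<^esub> v" using v by (rule A.a_rcos_self)
      ultimately have "(\<Union>u\<in>W +>\<^bsub>V\<^esub> v. W +>\<^bsub>V\<^esub> (c \<odot>\<^bsub>V\<^esub> u)) = W +>\<^bsub>V\<^esub> (c \<odot>\<^bsub>V\<^esub> v)"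
        by blast
      then show ?thesis by (simp add: quotient_space_def)
    qed
  qed
qed

text \<open>Rank-nullity for the map sending a vector to its coset.\<close>

lemma (in vectorspace) dim_quotient_space:
  assumes W: "submodule K W V" and fin: "fin_dim"
  shows "vectorspace.dim K (quotient_space V W) + vectorspace.dim K (vs W) = dim"
proof -
  interpret q: linear_map K V "quotient_space V W" "\<lambda>v. W +>\<^bsub>V\<^esub> v"
    by (rule linear_map_coset[OF W])
  interpret W: submodule K W V by (rule W)
  have im: "q.im = carrier (quotient_space V W)"
    by (auto simp: q.im_def quotient_space_def A_RCOSETS_def')
  have "v \<in> W \<longleftrightarrow> W +>\<^bsub>V\<^esub> v = W" if "v \<in> carrier V" for v
    using that W.subset M.a_coset_join1[OF _ _ subgroup_submodule[OF W]]
      M.a_coset_join2[OF _ subgroup_submodule[OF W]] by blast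
  then have ker: "q.ker = W"
    using W.subset unfolding q.ker_def by (auto simp: quotient_space_def)
  from q.rank_nullity[OF fin] show ?thesis unfolding im ker by simp
qed

text \<open>
  A linearly independent subset of \<open>W\<close> is also independent in \<open>V\<close>, which bounds its size; a maximal one
  is a basis of \<open>W\<close>.
\<close>

lemma (in vectorspace) fin_dim_submodule:
  assumes W: "submodule K W V" and fin: "fin_dim"
  shows "vectorspace.fin_dim K (vs W)"
proof -
  interpret W: submodule K W V by (rule W)
  interpret w: vectorspace K "vs W"
    using submodule_is_module[OF W] field_axioms by (simp add: vectorspace_def)
  have "finite S \<and> card S \<le> dim" if "S \<subseteq> carrier (vs W) \<and> w.lin_indpt S" for S
    using that li_le_dim[OF fin, of S] span_li_not_depend(2)[OF _ W, of S] W.subset by auto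
  moreover have "{} \<subseteq> carrier (vs W) \<and> w.lin_indpt {}"
    by (simp add: w.lin_dep_def)
  ultimately have "\<exists>S. finite S \<and> maximal S (\<lambda>S. S \<subseteq> carrier (vs W) \<and> w.lin_indpt S)"
    by (rule maximal_exists)
  then obtain S where "finite S" "maximal S (\<lambda>S. S \<subseteq> carrier (vs W) \<and> w.lin_indpt S)"
    by blast
  with w.max_li_is_basis have "w.basis S" by blast
  with \<open>finite S\<close> show ?thesis unfolding w.fin_dim_def w.basis_def by auto
qed

lemma func_space_simps:
  fixes a :: "'b :: field"
  defines "F \<equiv> ring.func_space (class_ring :: 'b ring)"
  shows "carrier (F S) = S \<rightarrow>\<^sub>E UNIV"
    and "\<zero>\<^bsub>F S\<^esub> = (\<lambda>s\<in>S. 0)"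
    and "f \<oplus>\<^bsub>F S\<^esub> g = (\<lambda>s\<in>S. f s + g s)"
    and "a \<odot>\<^bsub>F S\<^esub> f = (\<lambda>s\<in>S. a * f s)"
  by (simp_all add: F_def class_ring.func_space_def)

text \<open>An enumeration of \<open>S\<close> identifies the functions on \<open>S\<close> with the vectors of length \<open>card S\<close>.\<close>

lemma fin_dim_dim_func_space:
  assumes S: "finite S"
  shows "vectorspace.fin_dim (class_ring :: 'b :: field ring) (ring.func_space class_ring S)"
    and "vectorspace.dim (class_ring :: 'b ring) (ring.func_space class_ring S) = card S"
proof -
  let ?F = "ring.func_space (class_ring :: 'b ring) S"
  obtain h where h: "bij_betw h S {..<card S}"
    using ex_bij_betw_finite_nat[OF S] by (auto simp: atLeast0LessThan)
  interpret vec: vec_space "TYPE('b)" "card S" .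
  define T where "T x = (\<lambda>s\<in>S. x $ h s)" for x :: "'b vec"
  have hS: "h s < card S" if "s \<in> S" for s using h that by (auto simp: bij_betw_def)
  have surj: "T ` carrier_vec (card S) = carrier ?F"
  proof
    show "T ` carrier_vec (card S) \<subseteq> carrier ?F"
      by (auto simp: T_def class_ring.func_space_def)
    show "carrier ?F \<subseteq> T ` carrier_vec (card S)"
    proof
      fix g assume g: "g \<in> carrier ?F"
      then have "g = T (vec (card S) (\<lambda>i. g (inv_into S h i)))"
        using h hS by (auto simp: T_def class_ring.func_space_def bij_betw_def fun_eq_iff PiE_def extensional_def)
      then show "g \<in> T ` carrier_vec (card S)" by (metis imageI vec_carrier)
    qed
  qed
  have T: "linear_map class_ring (module_vec TYPE('b) (card S)) ?F T"
  proof (rule linear_map_onto_imageI[OF vec.vectorspace_axioms])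
    show "carrier ?F = T ` carrier (module_vec TYPE('b) (card S))"
      unfolding surj[symmetric] by (simp add: module_vec_simps)
    show "\<zero>\<^bsub>?F\<^esub> = T \<zero>\<^bsub>module_vec TYPE('b) (card S)\<^esub>"
      by (rule ext) (simp add: T_def func_space_simps module_vec_simps hS)
    fix v w :: "'b vec" and c :: 'b
    assume v: "v \<in> carrier (module_vec TYPE('b) (card S))"
    then show "T (c \<odot>\<^bsub>module_vec TYPE('b) (card S)\<^esub> v) = c \<odot>\<^bsub>?F\<^esub> T v"
      by (intro ext) (simp add: T_def func_space_simps module_vec_simps hS)
    assume w: "w \<in> carrier (module_vec TYPE('b) (card S))"
    with v show "T (v \<oplus>\<^bsub>module_vec TYPE('b) (card S)\<^esub> w) = T v \<oplus>\<^bsub>?F\<^esub> T w"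
      by (intro ext) (simp add: T_def func_space_simps module_vec_simps hS)
  qed
  have inj: "inj_on T (carrier_vec (card S))"
  proof (rule inj_onI)
    fix x y :: "'b vec" assume x: "x \<in> carrier_vec (card S)" and y: "y \<in> carrier_vec (card S)"
      and eq: "T x = T y"
    have "x $ i = y $ i" if "i < card S" for i
    proof -
      have "i \<in> h ` S" using bij_betw_imp_surj_on[OF h] that by simp
      then obtain s where "i = h s" "s \<in> S" by (rule imageE)
      with fun_cong[OF eq, of s] show ?thesis by (simp add: T_def)
    qed
    with x y show "x = y" by (intro eq_vecI) auto
  qed
  show "vectorspace.fin_dim class_ring ?F"
    by (rule linear_map.surj_fin_dim[OF T vec.fin_dim]) (simp add: module_vec_simps surj)
  show "vectorspace.dim class_ring ?F = card S"
    using linear_map.dim_eq[OF T vec.fin_dim] inj surj by (simp add: module_vec_simps vec.dim_is_n)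
qed

section \<open>Ranks of homology and of boundaries\<close>

lemma chain_space_simps:
  "carrier (chain_space K k) = dim_cells K k \<rightarrow>\<^sub>E UNIV"
  "\<zero>\<^bsub>chain_space K k\<^esub> = (\<lambda>\<sigma>\<in>dim_cells K k. 0)"
  "c \<oplus>\<^bsub>chain_space K k\<^esub> d = (\<lambda>\<sigma>\<in>dim_cells K k. c \<sigma> + d \<sigma>)"
  "a \<odot>\<^bsub>chain_space K k\<^esub> c = (\<lambda>\<sigma>\<in>dim_cells K k. a * c \<sigma>)"
  by (simp_all add: chain_space_def func_space_simps)

lemma vectorspace_func_space: "vectorspace (class_ring :: 'b :: field ring) (ring.func_space class_ring S)"
proof -
  interpret vec_space "TYPE('b)" 0 .
  show ?thesis by (rule func_space_is_vs)
qed

lemma vectorspace_chain_space: "vectorspace class_ring (chain_space K k)"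
  unfolding chain_space_def by (rule vectorspace_func_space)

lemma linear_map_boundary:
  "linear_map class_ring (chain_space K k) (chain_space K (k - 1)) (boundary K k)"
  by (rule linear_mapI[OF vectorspace_chain_space vectorspace_chain_space])
    (auto simp: chain_space_simps boundary_def fun_eq_iff sum.distrib sum_distrib_left algebra_simps)

lemma linear_map_onto_boundaries:
  "linear_map class_ring (chain_space K (k + 1)) ((chain_space K k)\<lparr>carrier := boundaries K k\<rparr>)
     (boundary K (k + 1))"
proof -
  interpret b: linear_map class_ring "chain_space K (k + 1)" "chain_space K k" "boundary K (k + 1)"
    using linear_map_boundary[of K "k + 1"] by simp
  show ?thesis
    by (rule linear_map_onto_imageI[OF vectorspace_chain_space]) (auto simp: boundaries_def)
qed

context lefschetz_complex
begin

lemma fin_dim_chain_space: "vectorspace.fin_dim class_ring (chain_space K k)"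
  and dim_chain_space: "vectorspace.dim class_ring (chain_space K k) = card (dim_cells K k)"
  unfolding chain_space_def using fin_dim_dim_func_space[OF finite_dim_cells'] by blast+

lemma fin_dim_boundaries:
  "vectorspace.fin_dim class_ring ((chain_space K k)\<lparr>carrier := boundaries K k\<rparr>)"
proof -
  interpret b: linear_map class_ring "chain_space K (k + 1)"
      "(chain_space K k)\<lparr>carrier := boundaries K k\<rparr>" "boundary K (k + 1)"
    by (rule linear_map_onto_boundaries)
  show ?thesis
    by (rule b.surj_fin_dim[OF fin_dim_chain_space]) (simp add: boundaries_def)
qed

lemma boundary_boundary:
  "boundary K (k - 1) (boundary K k c) = (\<lambda>\<sigma>\<in>dim_cells K (k - 2). 0)"
proof -
  have "(\<Sum>\<tau>\<in>dim_cells K (k - 1). (\<Sum>\<rho>\<in>dim_cells K k. c \<rho> * inc K \<rho> \<tau>) * inc K \<tau> \<sigma>) = 0"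
    if s: "\<sigma> \<in> dim_cells K (k - 2)" for \<sigma>
  proof -
    have "(\<Sum>\<tau>\<in>dim_cells K (k - 1). (\<Sum>\<rho>\<in>dim_cells K k. c \<rho> * inc K \<rho> \<tau>) * inc K \<tau> \<sigma>)
        = (\<Sum>\<rho>\<in>dim_cells K k. c \<rho> * (\<Sum>\<tau>\<in>dim_cells K (k - 1). inc K \<rho> \<tau> * inc K \<tau> \<sigma>))"
      unfolding sum_distrib_left sum_distrib_right
      by (subst sum.swap) (simp add: mult.assoc)
    also have "(\<Sum>\<tau>\<in>dim_cells K (k - 1). inc K \<rho> \<tau> * inc K \<tau> \<sigma>) = 0" if "\<rho> \<in> dim_cells K k" for \<rho>
      by (rule L2_sum[OF _ _ finite_dim_cells']) (use that s L1 in \<open>fastforce simp: dim_cells_def\<close>)+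
    then have "(\<Sum>\<rho>\<in>dim_cells K k. c \<rho> * (\<Sum>\<tau>\<in>dim_cells K (k - 1). inc K \<rho> \<tau> * inc K \<tau> \<sigma>)) = 0"
      by simp
    finally show ?thesis .
  qed
  then show ?thesis by (auto simp: boundary_def fun_eq_iff)
qed

lemma boundaries_subset_cycles: "boundaries K k \<subseteq> cycles K k"
proof
  fix b assume "b \<in> boundaries K k"
  then obtain c where "b = boundary K (k + 1) c" by (auto simp: boundaries_def)
  then show "b \<in> cycles K k"
    using boundary_boundary[of "k + 1" c]
    by (simp add: cycles_def a_kernel_def kernel_def chain_space_simps boundary_def)
qed

text \<open>
  Homology is \<open>Z_k / B_k\<close>, and rank-nullity for \<open>\<partial>_k\<close> gives \<open>dim Z_k + dim B_{k-1}\<close>. This identity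
  reduces statements about homology to ranks of boundaries and numbers of cells.
\<close>

lemma rank_homology_eq:
  "rank_homology K k + rank_boundaries K k + rank_boundaries K (k - 1) = card (dim_cells K k)"
proof -
  interpret b: linear_map class_ring "chain_space K k" "chain_space K (k - 1)" "boundary K k"
    by (rule linear_map_boundary)
  interpret up: linear_map class_ring "chain_space K (k + 1)" "chain_space K k" "boundary K (k + 1)"
    using linear_map_boundary[of K "k + 1"] by simp
  let ?Z = "(chain_space K k)\<lparr>carrier := cycles K k\<rparr>"
  have ker: "b.ker = cycles K k"
    unfolding b.ker_def by (auto simp: cycles_def a_kernel_def kernel_def)
  interpret Z: vectorspace class_ring ?Z
    using b.V.subspace_is_vs[OF b.kerT_is_subspace] by (simp add: ker)
  have finZ: "Z.fin_dim"
    using b.V.fin_dim_submodule[OF b.ker_is_submodule fin_dim_chain_space] by (simp add: ker)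
  have "b.im = boundaries K (k - 1)"
    unfolding b.im_def by (simp add: boundaries_def)
  with b.rank_nullity[OF fin_dim_chain_space]
  have 1: "rank_boundaries K (k - 1) + Z.dim = card (dim_cells K k)"
    by (simp add: ker rank_boundaries_def dim_chain_space)
  have "up.im = boundaries K k"
    unfolding up.im_def by (simp add: boundaries_def)
  then have "submodule class_ring (boundaries K k) ?Z"
    using up.im_is_submodule boundaries_subset_cycles
    by (auto simp: submodule_def Z.module_axioms)
  from Z.dim_quotient_space[OF this finZ]
  have "rank_homology K k + rank_boundaries K k = Z.dim"
    by (simp add: rank_homology_def homology_def rank_boundaries_def)
  with 1 show ?thesis by simp
qed

end

section \<open>Cancelling a pair of cells\<close>

text \<open>
  The coefficients of \<open>c - (c \<kappa> / w \<mu> \<kappa>) \<partial>\<mu>\<close> at the surviving cells. The formula is used in all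
  degrees: if \<open>\<kappa>\<close> is not a \<open>k\<close>-cell, then \<open>c \<kappa>\<close> is an arbitrary default value, but \<open>inc K \<mu> \<sigma>\<close>
  vanishes on \<open>k\<close>-cells, and the map is restriction to the surviving cells.
\<close>

definition cancel_chain :: "'a lefschetz \<Rightarrow> 'a \<Rightarrow> 'a \<Rightarrow> int \<Rightarrow> ('a \<Rightarrow> real) \<Rightarrow> ('a \<Rightarrow> real)" where
  "cancel_chain K \<mu> \<kappa> k c =
     (\<lambda>\<sigma>\<in>dim_cells (cancel_pair K \<mu> \<kappa>) k. c \<sigma> - c \<kappa> * inc K \<mu> \<sigma> / inc K \<mu> \<kappa>)"

lemma dim_cells_cancel_pair: "dim_cells (cancel_pair K \<mu> \<kappa>) k = dim_cells K k - {\<mu>, \<kappa>}"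
  by (auto simp: dim_cells_def cancel_pair_simps)

locale lefschetz_pair = lefschetz_complex +
  fixes \<mu> \<kappa> :: 'a
  assumes mu: "\<mu> \<in> cells K" and kappa: "\<kappa> \<in> cells K" and inc_mu_kappa: "inc K \<mu> \<kappa> \<noteq> 0"
begin

abbreviation "K' \<equiv> cancel_pair K \<mu> \<kappa>"

lemma cdim_mu: "int (cdim K \<mu>) = int (cdim K \<kappa>) + 1"
  using L1[OF mu kappa inc_mu_kappa] by simp

lemma mu_neq_kappa: "\<mu> \<noteq> \<kappa>"
  using cdim_mu by auto

lemma inc_mu_eq_0: "\<sigma> \<in> dim_cells K k \<Longrightarrow> \<kappa> \<notin> dim_cells K k \<Longrightarrow> inc K \<mu> \<sigma> = 0"
  using L1[OF mu, of \<sigma>] cdim_mu kappa by (auto simp: dim_cells_def)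

text \<open>
  Both sides at \<open>\<sigma>\<close> equal the sum of \<open>c \<tau> * w' \<tau> \<sigma>\<close> over all \<open>\<tau>\<close>, the removed cells included. On the
  left, the correction term contributes a multiple of the sum of \<open>w \<mu> \<tau> * w' \<tau> \<sigma>\<close>, which vanishes by
  \<open>L2\<close>; on the right, the correction term is the one in the definition of \<open>w'\<close>.
\<close>

lemma boundary_cancel_chain:
  "boundary K' (k + 1) (cancel_chain K \<mu> \<kappa> (k + 1) c) = cancel_chain K \<mu> \<kappa> k (boundary K (k + 1) c)"
proof
  fix \<sigma>
  let ?w = "inc K" and ?w' = "inc K'" and ?D = "dim_cells K (k + 1)"
  show "boundary K' (k + 1) (cancel_chain K \<mu> \<kappa> (k + 1) c) \<sigma>
      = cancel_chain K \<mu> \<kappa> k (boundary K (k + 1) c) \<sigma>"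
  proof (cases "\<sigma> \<in> dim_cells K' k")
    case False
    then show ?thesis by (simp add: boundary_def cancel_chain_def)
  next
    case True
    then have s: "\<sigma> \<in> dim_cells K k" "\<sigma> \<in> cells K" by (auto simp: dim_cells_cancel_pair) (auto simp: dim_cells_def)
    have "(\<Sum>\<tau>\<in>?D. ?w \<mu> \<tau> * ?w \<tau> \<nu>) = 0" if "\<nu> \<in> {\<sigma>, \<kappa>}" for \<nu>
    proof (rule L2_sum[OF mu _ finite_dim_cells'])
      show "\<nu> \<in> cells K" using that s kappa by auto
      show "?D \<subseteq> cells K" by (auto simp: dim_cells_def)
      fix \<tau> assume \<tau>: "\<tau> \<in> cells K" "?w \<mu> \<tau> \<noteq> 0" "?w \<tau> \<nu> \<noteq> 0"
      \<comment> \<open>For \<open>\<nu> = \<kappa>\<close> no such \<open>\<tau>\<close> exists, as the dimensions of \<open>\<mu>\<close> and \<open>\<kappa>\<close> differ by one.\<close>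
      have "\<nu> \<noteq> \<kappa>" using L1[OF mu \<tau>(1,2)] L1[OF \<tau>(1) kappa] \<tau>(3) cdim_mu by auto
      then have "\<nu> = \<sigma>" using that by simp
      then show "\<tau> \<in> ?D" using L1[OF \<tau>(1) s(2)] \<tau> s(1) by (simp add: dim_cells_def)
    qed
    then have "0 = (\<Sum>\<tau>\<in>?D. ?w \<mu> \<tau> * ?w \<tau> \<sigma>) - (\<Sum>\<tau>\<in>?D. ?w \<mu> \<tau> * ?w \<tau> \<kappa>) * (?w \<mu> \<sigma> / ?w \<mu> \<kappa>)"
      by simp
    also have "\<dots> = (\<Sum>\<tau>\<in>?D. ?w \<mu> \<tau> * ?w' \<tau> \<sigma>)"
      unfolding sum_distrib_right sum_subtractf[symmetric]
      by (rule sum.cong) (simp_all add: cancel_pair_simps algebra_simps)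
    finally have Z: "(\<Sum>\<tau>\<in>?D. ?w \<mu> \<tau> * ?w' \<tau> \<sigma>) = 0" by simp
    have "boundary K' (k + 1) (cancel_chain K \<mu> \<kappa> (k + 1) c) \<sigma>
        = (\<Sum>\<tau>\<in>dim_cells K' (k + 1). (c \<tau> - c \<kappa> * ?w \<mu> \<tau> / ?w \<mu> \<kappa>) * ?w' \<tau> \<sigma>)"
      using True by (simp add: boundary_def cancel_chain_def)
    \<comment> \<open>The new terms are zero: at \<open>\<kappa>\<close> the coefficient vanishes, at \<open>\<mu>\<close> the incidence \<open>w' \<mu> \<sigma>\<close> does.\<close>
    also have "\<dots> = (\<Sum>\<tau>\<in>?D. (c \<tau> - c \<kappa> * ?w \<mu> \<tau> / ?w \<mu> \<kappa>) * ?w' \<tau> \<sigma>)"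
      using inc_mu_kappa
      by (intro sum.mono_neutral_left) (auto simp: finite_dim_cells' dim_cells_cancel_pair cancel_pair_simps)
    also have "\<dots> = (\<Sum>\<tau>\<in>?D. c \<tau> * ?w' \<tau> \<sigma>) - c \<kappa> / ?w \<mu> \<kappa> * (\<Sum>\<tau>\<in>?D. ?w \<mu> \<tau> * ?w' \<tau> \<sigma>)"
      unfolding sum_distrib_left sum_subtractf[symmetric]
      by (rule sum.cong) (simp_all add: algebra_simps)
    also have "\<dots> = (\<Sum>\<tau>\<in>?D. c \<tau> * ?w \<tau> \<sigma>) - (\<Sum>\<tau>\<in>?D. c \<tau> * ?w \<tau> \<kappa>) * (?w \<mu> \<sigma> / ?w \<mu> \<kappa>)"
      unfolding Z sum_distrib_right mult_zero_right diff_zero sum_subtractf[symmetric]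
      by (rule sum.cong) (simp_all add: cancel_pair_simps algebra_simps)
    also have "\<dots> = cancel_chain K \<mu> \<kappa> k (boundary K (k + 1) c) \<sigma>"
      using True s inc_mu_eq_0[OF s(1)]
      by (cases "\<kappa> \<in> dim_cells K k") (simp_all add: boundary_def cancel_chain_def)
    finally show ?thesis .
  qed
qed

lemma cancel_chain_image: "cancel_chain K \<mu> \<kappa> k ` carrier (chain_space K k) = carrier (chain_space K' k)"
proof
  show "cancel_chain K \<mu> \<kappa> k ` carrier (chain_space K k) \<subseteq> carrier (chain_space K' k)"
    by (auto simp: cancel_chain_def chain_space_simps)
  show "carrier (chain_space K' k) \<subseteq> cancel_chain K \<mu> \<kappa> k ` carrier (chain_space K k)"
  proof
    fix c assume c: "c \<in> carrier (chain_space K' k)"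
    define d where "d = (\<lambda>\<sigma>\<in>dim_cells K k. if \<sigma> \<in> {\<mu>, \<kappa>} then 0 else c \<sigma>)"
    have "cancel_chain K \<mu> \<kappa> k d \<sigma> = c \<sigma>" for \<sigma>
      using c inc_mu_eq_0[of \<sigma> k]
      by (cases "\<kappa> \<in> dim_cells K k")
        (auto simp: cancel_chain_def d_def dim_cells_cancel_pair chain_space_simps PiE_def extensional_def)
    moreover have "d \<in> carrier (chain_space K k)" by (simp add: d_def chain_space_simps)
    ultimately show "c \<in> cancel_chain K \<mu> \<kappa> k ` carrier (chain_space K k)" by (metis ext imageI)
  qed
qed

lemma cancel_chain_boundaries: "cancel_chain K \<mu> \<kappa> k ` boundaries K k = boundaries K' k"
proof -
  have "cancel_chain K \<mu> \<kappa> k ` boundaries K k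
      = boundary K' (k + 1) ` cancel_chain K \<mu> \<kappa> (k + 1) ` carrier (chain_space K (k + 1))"
    by (simp add: boundaries_def image_image boundary_cancel_chain)
  then show ?thesis by (simp add: boundaries_def cancel_chain_image)
qed

lemma linear_map_cancel_chain:
  "linear_map class_ring ((chain_space K k)\<lparr>carrier := boundaries K k\<rparr>) (chain_space K' k)
     (cancel_chain K \<mu> \<kappa> k)" (is "linear_map _ ?B _ _")
proof (rule linear_mapI[OF linear_map.axioms(2)[OF linear_map_onto_boundaries] vectorspace_chain_space])
  show "cancel_chain K \<mu> \<kappa> k v \<in> carrier (chain_space K' k)" for v
    by (simp add: cancel_chain_def chain_space_simps)
  let ?\<pi> = "cancel_chain K \<mu> \<kappa> k"
  have lin: "?\<pi> (\<lambda>\<sigma>\<in>dim_cells K k. a * c \<sigma> + b * d \<sigma>)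
      = (\<lambda>\<sigma>\<in>dim_cells K' k. a * ?\<pi> c \<sigma> + b * ?\<pi> d \<sigma>)" for a b :: real and c d
  proof
    fix \<sigma>
    show "?\<pi> (\<lambda>\<sigma>\<in>dim_cells K k. a * c \<sigma> + b * d \<sigma>) \<sigma>
      = (\<lambda>\<sigma>\<in>dim_cells K' k. a * ?\<pi> c \<sigma> + b * ?\<pi> d \<sigma>) \<sigma>"
    proof (cases "\<sigma> \<in> dim_cells K' k")
      case True
      then have \<sigma>: "\<sigma> \<in> dim_cells K k" by (simp add: dim_cells_cancel_pair)
      show ?thesis
      proof (cases "\<kappa> \<in> dim_cells K k")
        case \<kappa>: True
        with True \<sigma> inc_mu_kappa show ?thesis by (simp add: cancel_chain_def field_simps)
      next
        case False
        with True \<sigma> inc_mu_eq_0[OF \<sigma>] show ?thesis by (simp add: cancel_chain_def)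
      qed
    qed (simp add: cancel_chain_def)
  qed
  show "?\<pi> (v \<oplus>\<^bsub>?B\<^esub> w) = ?\<pi> v \<oplus>\<^bsub>chain_space K' k\<^esub> ?\<pi> w" for v w
    using lin[of 1 v 1 w] by (simp add: chain_space_simps)
  show "?\<pi> (r \<odot>\<^bsub>?B\<^esub> v) = r \<odot>\<^bsub>chain_space K' k\<^esub> ?\<pi> v" for r v
    using lin[of r v 0] by (simp add: chain_space_simps)
qed

text \<open>
  The right-hand side consists of the multiples of \<open>\<partial>\<mu>\<close> if \<open>\<kappa>\<close> is a \<open>k\<close>-cell and of zero only
  otherwise; writing it as an image of the functions on \<open>{\<kappa>} \<inter> dim_cells K k\<close> covers both cases. A
  boundary \<open>b\<close> in the kernel is determined by \<open>b \<kappa>\<close>, except for its value at \<open>\<mu>\<close>. If \<open>\<mu>\<close> is a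
  \<open>k\<close>-cell, then \<open>b\<close> is zero at all other \<open>k\<close>-cells, so that \<open>\<partial>b = 0\<close> at \<open>\<kappa>\<close> reads
  \<open>b \<mu> * w \<mu> \<kappa> = 0\<close>.
\<close>

lemma cancel_chain_kernel:
  "{b \<in> boundaries K k. cancel_chain K \<mu> \<kappa> k b = \<zero>\<^bsub>chain_space K' k\<^esub>}
     = (\<lambda>a. \<lambda>\<sigma>\<in>dim_cells K k. a \<kappa> * inc K \<mu> \<sigma> / inc K \<mu> \<kappa>) ` ({\<kappa>} \<inter> dim_cells K k \<rightarrow>\<^sub>E UNIV)"
  (is "?N = ?T ` ?A")
proof
  let ?D = "dim_cells K k"
  have mu_mem: "\<mu> \<in> dim_cells K (k + 1) \<longleftrightarrow> \<kappa> \<in> ?D"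
    using mu kappa cdim_mu by (auto simp: dim_cells_def)
  show "?T ` ?A \<subseteq> ?N"
  proof (rule image_subsetI)
    fix a assume "a \<in> ?A"
    \<comment> \<open>The multiple of \<open>\<mu>\<close> whose boundary is the given one; it is zero if \<open>\<mu>\<close> is not a \<open>(k + 1)\<close>-cell.\<close>
    define c where "c = (\<lambda>\<tau>\<in>dim_cells K (k + 1). if \<tau> = \<mu> then a \<kappa> / inc K \<mu> \<kappa> else 0)"
    have "boundary K (k + 1) c \<sigma> = ?T a \<sigma>" for \<sigma>
    proof (cases "\<sigma> \<in> ?D")
      case True
      have "(\<Sum>\<tau>\<in>dim_cells K (k + 1). c \<tau> * inc K \<tau> \<sigma>)
          = (\<Sum>\<tau>\<in>dim_cells K (k + 1). if \<tau> = \<mu> then a \<kappa> / inc K \<mu> \<kappa> * inc K \<mu> \<sigma> else 0)"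
        by (rule sum.cong) (auto simp: c_def)
      also have "\<dots> = a \<kappa> * inc K \<mu> \<sigma> / inc K \<mu> \<kappa>"
        using inc_mu_eq_0[OF True] by (auto simp: finite_dim_cells' mu_mem)
      finally show ?thesis using True by (simp add: boundary_def)
    qed (simp add: boundary_def)
    moreover have "c \<in> carrier (chain_space K (k + 1))"
      by (simp add: c_def chain_space_simps)
    ultimately have "?T a \<in> boundaries K k"
      unfolding boundaries_def by (metis (no_types, lifting) ext imageI)
    moreover have "cancel_chain K \<mu> \<kappa> k (?T a) = \<zero>\<^bsub>chain_space K' k\<^esub>"
      using inc_mu_kappa inc_mu_eq_0[of _ k]
      by (auto simp: cancel_chain_def chain_space_simps dim_cells_cancel_pair fun_eq_iff)
    ultimately show "?T a \<in> ?N" by simp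
  qed
  show "?N \<subseteq> ?T ` ?A"
  proof
    fix b assume "b \<in> ?N"
    then obtain c where bc: "b = boundary K (k + 1) c"
      and ker: "cancel_chain K \<mu> \<kappa> k b = \<zero>\<^bsub>chain_space K' k\<^esub>"
      by (auto simp: boundaries_def)
    have b: "b \<sigma> = b \<kappa> * inc K \<mu> \<sigma> / inc K \<mu> \<kappa>" if "\<sigma> \<in> ?D" "\<sigma> \<noteq> \<mu>" for \<sigma>
    proof (cases "\<sigma> = \<kappa>")
      case False
      then show ?thesis
        using fun_cong[OF ker, of \<sigma>] that
        by (simp add: cancel_chain_def chain_space_simps dim_cells_cancel_pair)
    qed (simp add: inc_mu_kappa)
    have b_mu: "b \<mu> = 0" if m: "\<mu> \<in> ?D"
    proof -
      have k: "\<kappa> \<notin> ?D" "\<kappa> \<in> dim_cells K (k - 1)"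
        using m kappa cdim_mu by (auto simp: dim_cells_def)
      have "boundary K k b = (\<lambda>\<sigma>\<in>dim_cells K (k - 1). 0)"
        using boundary_boundary[of "k + 1" c] by (simp add: bc)
      from fun_cong[OF this, of \<kappa>] k(2) have "(\<Sum>\<tau>\<in>?D. b \<tau> * inc K \<tau> \<kappa>) = 0"
        by (simp add: boundary_def)
      also have "(\<Sum>\<tau>\<in>?D. b \<tau> * inc K \<tau> \<kappa>) = (\<Sum>\<tau>\<in>{\<mu>}. b \<tau> * inc K \<tau> \<kappa>)"
        using m b inc_mu_eq_0[OF _ k(1)]
        by (intro sum.mono_neutral_right) (auto simp: finite_dim_cells')
      finally show "b \<mu> = 0" using inc_mu_kappa by simp
    qed
    have b_eq: "b = ?T (\<lambda>s\<in>{\<kappa>} \<inter> ?D. b s)"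
    proof
      fix \<sigma>
      consider "\<sigma> \<notin> ?D" | "\<sigma> \<in> ?D" "\<sigma> = \<mu>" | "\<sigma> \<in> ?D" "\<sigma> \<noteq> \<mu>" by blast
      then show "b \<sigma> = ?T (\<lambda>s\<in>{\<kappa>} \<inter> ?D. b s) \<sigma>"
      proof cases
        case 1
        then show ?thesis by (simp add: bc boundary_def)
      next
        case 2
        then have "inc K \<mu> \<mu> = 0" using L1[OF mu mu] by auto
        with 2 b_mu show ?thesis by simp
      next
        case 3
        with b[OF 3] inc_mu_eq_0[OF 3(1)] show ?thesis by (cases "\<kappa> \<in> ?D") simp_all
      qed
    qed
    have "restrict b ({\<kappa>} \<inter> ?D) \<in> ?A" by (auto simp: PiE_def)
    from imageI[OF this, of ?T] show "b \<in> ?T ` ?A" by (simp only: b_eq[symmetric])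
  qed
qed

text \<open>
  Rank-nullity for \<open>cancel_chain\<close> on the boundaries of degree \<open>k\<close>: its image is the space of boundaries
  of \<open>K'\<close>, and its kernel is isomorphic to the space of functions on \<open>{\<kappa>} \<inter> dim_cells K k\<close>.
\<close>

lemma rank_boundaries_cancel_pair:
  "rank_boundaries K k = rank_boundaries K' k + (if k = int (cdim K \<kappa>) then 1 else 0)"
proof -
  let ?\<pi> = "cancel_chain K \<mu> \<kappa> k" and ?D = "dim_cells K k"
  let ?S = "{\<kappa>} \<inter> ?D"
  let ?B = "(chain_space K k)\<lparr>carrier := boundaries K k\<rparr>"
  let ?F = "ring.func_space class_ring ?S :: (real, 'a \<Rightarrow> real) module"
  let ?N = "(chain_space K k)\<lparr>carrier := {b \<in> boundaries K k. ?\<pi> b = \<zero>\<^bsub>chain_space K' k\<^esub>}\<rparr>"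
  interpret pi: linear_map class_ring ?B "chain_space K' k" ?\<pi>
    by (rule linear_map_cancel_chain)
  define T where "T a = (\<lambda>\<sigma>\<in>?D. a \<kappa> * inc K \<mu> \<sigma> / inc K \<mu> \<kappa>)" for a :: "'a \<Rightarrow> real"
  have T_image: "T ` carrier ?F = carrier ?N"
    unfolding T_def by (simp add: func_space_simps cancel_chain_kernel)
  interpret T: linear_map class_ring ?F ?N T
    by (rule linear_map_onto_imageI[OF vectorspace_func_space])
      (simp only: T_image, auto simp: T_def func_space_simps chain_space_simps fun_eq_iff
         inc_mu_eq_0 add_divide_distrib algebra_simps)
  have "inj_on T (carrier ?F)"
  proof (rule inj_onI, rule ext)
    fix a b x assume ab: "a \<in> carrier ?F" "b \<in> carrier ?F" and eq: "T a = T b"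
    show "a x = b x"
    proof (cases "x \<in> ?S")
      case True
      then have "x = \<kappa>" "\<kappa> \<in> ?D" by auto
      with fun_cong[OF eq, of \<kappa>] inc_mu_kappa show ?thesis by (simp add: T_def)
    next
      case False
      then show ?thesis using ab by (simp add: func_space_simps PiE_def extensional_def)
    qed
  qed
  then have "T.W.dim = card ?S"
    using T.dim_eq T_image fin_dim_dim_func_space[of ?S, where 'b = real] by simp
  moreover have "pi.ker = carrier ?N" unfolding pi.ker_def by auto
  moreover have "pi.im = boundaries K' k" unfolding pi.im_def by (simp add: cancel_chain_boundaries)
  moreover have "card ?S = (if k = int (cdim K \<kappa>) then 1 else 0)"
    using kappa by (auto simp: dim_cells_def)
  ultimately show ?thesis
    using pi.rank_nullity[OF fin_dim_boundaries] by (simp add: rank_boundaries_def)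
qed


lemma card_dim_cells_cancel_pair:
  "card (dim_cells K k) = card (dim_cells K' k)
     + (if k = int (cdim K \<mu>) then 1 else 0) + (if k = int (cdim K \<kappa>) then 1 else 0)"
proof -
  have "dim_cells K k = dim_cells K' k \<union> ({\<mu>, \<kappa>} \<inter> dim_cells K k)"
    by (auto simp: dim_cells_cancel_pair)
  then have "card (dim_cells K k) = card (dim_cells K' k) + card ({\<mu>, \<kappa>} \<inter> dim_cells K k)"
    by (metis card_Un_disjoint Diff_disjoint Int_Diff Int_commute dim_cells_cancel_pair finite_Int
        finite_Un finite_dim_cells' inf_assoc)
  moreover have "card ({\<mu>, \<kappa>} \<inter> dim_cells K k)
      = (if k = int (cdim K \<mu>) then 1 else 0) + (if k = int (cdim K \<kappa>) then 1 else 0)"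
    using mu kappa cdim_mu mu_neq_kappa by (auto simp: dim_cells_def)
  ultimately show ?thesis by simp
qed

lemma rank_homology_cancel_pair: "rank_homology K' k = rank_homology K k"
proof -
  interpret K': lefschetz_complex K'
    by (rule lefschetz_complex_cancel_pair[OF mu kappa inc_mu_kappa])
  show ?thesis
    using rank_homology_eq[of k] K'.rank_homology_eq[of k] rank_boundaries_cancel_pair[of k]
      rank_boundaries_cancel_pair[of "k - 1"] card_dim_cells_cancel_pair[of k] cdim_mu
    by (auto split: if_splits)
qed

lemma poincare_series_cancel_pair: "poincare_series K' = poincare_series K"
  by (simp add: poincare_series_def rank_homology_cancel_pair)

end

section \<open>Cancellation and discrete Morse--Bott functions\<close>

text \<open>
  Complexes are records of total functions, so the identifications of weakly critical complexes below
  hold on cells only. This suffices, because chains and boundary maps see nothing else.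
\<close>

lemma rank_cong:
  assumes "cells L = cells M"
    and "\<And>\<sigma>. \<sigma> \<in> cells M \<Longrightarrow> cdim L \<sigma> = cdim M \<sigma>"
    and "\<And>\<tau> \<sigma>. \<tau> \<in> cells M \<Longrightarrow> \<sigma> \<in> cells M \<Longrightarrow> inc L \<tau> \<sigma> = inc M \<tau> \<sigma>"
  shows rank_homology_cong: "rank_homology L k = rank_homology M k"
    and rank_boundaries_cong: "rank_boundaries L k = rank_boundaries M k"
proof -
  have dc: "dim_cells L j = dim_cells M j" for j
    using assms(1,2) by (auto simp: dim_cells_def)
  have bd: "boundary L j = boundary M j" for j
  proof (rule ext)+
    fix c \<sigma>
    show "boundary L j c \<sigma> = boundary M j c \<sigma>"
      unfolding boundary_def dc restrict_def
      using assms(3) by (auto simp: dim_cells_def intro!: sum.cong)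
  qed
  have "chain_space L j = chain_space M j" for j
    by (simp add: chain_space_def dc)
  with bd show "rank_homology L k = rank_homology M k" "rank_boundaries L k = rank_boundaries M k"
    by (simp_all add: rank_homology_def homology_def rank_boundaries_def cycles_def boundaries_def)
qed

lemma poincare_series_cong:
  assumes "\<And>k. rank_homology L k = rank_homology M k"
  shows "poincare_series L = poincare_series M"
  using assms by (simp add: poincare_series_def)

context lefschetz_complex
begin

lemma up_snc_unique:
  assumes "discrete_morse_bott K f" "\<sigma> \<in> cells K"
    and "\<tau> \<in> cells K" "inc K \<tau> \<sigma> \<noteq> 0" "f \<tau> < f \<sigma>"
    and "\<tau>' \<in> cells K" "inc K \<tau>' \<sigma> \<noteq> 0" "f \<tau>' < f \<sigma>"
  shows "\<tau> = \<tau>'"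
  using assms finite_up[OF assms(2), of "\<lambda>\<tau>. f \<sigma> > f \<tau>"]
  by (auto simp: discrete_morse_bott_def up_snc_def card_le_Suc0_iff_eq)

lemma down_snc_unique:
  assumes "discrete_morse_bott K f" "\<sigma> \<in> cells K"
    and "\<nu> \<in> cells K" "inc K \<sigma> \<nu> \<noteq> 0" "f \<sigma> < f \<nu>"
    and "\<nu>' \<in> cells K" "inc K \<sigma> \<nu>' \<noteq> 0" "f \<sigma> < f \<nu>'"
  shows "\<nu> = \<nu>'"
  using assms finite_down[OF assms(2), of "\<lambda>\<nu>. f \<sigma> < f \<nu>"]
  by (auto simp: discrete_morse_bott_def down_snc_def card_le_Suc0_iff_eq)

end

locale morse_bott_pair = lefschetz_pair +
  fixes f :: "'a \<Rightarrow> real"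
  assumes morse_bott: "discrete_morse_bott K f"
    and cancellable: "f \<mu> < f \<kappa> \<or> (weakly_critical K f \<mu> \<and> weakly_critical K f \<kappa> \<and> f \<mu> = f \<kappa>)"
begin

lemma f_mu_le_f_kappa: "f \<mu> \<le> f \<kappa>"
  using cancellable by auto

text \<open>
  If \<open>f \<mu> < f \<kappa>\<close>, then \<open>\<mu>\<close> is the only cell counted by \<open>U \<kappa>\<close>, and \<open>\<kappa>\<close> the only one counted by
  \<open>D \<mu>\<close>; in the other case nothing is counted at either cell.
\<close>

lemma f_above_kappa:
  assumes "\<tau> \<in> cells K" "\<tau> \<noteq> \<mu>" "inc K \<tau> \<kappa> \<noteq> 0"
  shows "f \<kappa> \<le> f \<tau>"
  using cancellable
proof
  assume "f \<mu> < f \<kappa>"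
  then show ?thesis
    using up_snc_unique[OF morse_bott kappa mu inc_mu_kappa _ assms(1,3)] assms(2) by force
qed (use assms in \<open>auto simp: weakly_critical_iff\<close>)

lemma f_below_mu:
  assumes "\<sigma> \<in> cells K" "\<sigma> \<noteq> \<kappa>" "inc K \<mu> \<sigma> \<noteq> 0"
  shows "f \<sigma> \<le> f \<mu>"
  using cancellable
proof
  assume "f \<mu> < f \<kappa>"
  then show ?thesis
    using down_snc_unique[OF morse_bott mu kappa inc_mu_kappa _ assms(1,3)] assms(2) by force
qed (use assms in \<open>auto simp: weakly_critical_iff\<close>)

lemma inc_cancel_pair_less:
  assumes "\<tau> \<in> cells K'" "\<sigma> \<in> cells K'" and less: "f \<tau> < f \<sigma>"
  shows "inc K' \<tau> \<sigma> = inc K \<tau> \<sigma>"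
proof -
  have "inc K \<tau> \<kappa> = 0 \<or> inc K \<mu> \<sigma> = 0"
    using f_above_kappa[of \<tau>] f_below_mu[of \<sigma>] f_mu_le_f_kappa assms
    by (force simp: cancel_pair_simps)
  then show ?thesis by (auto simp: cancel_pair_simps)
qed

text \<open>
  For \<open>\<rho> = \<kappa>\<close>: the incidences \<open>\<mu> \<rightarrow> \<kappa> \<rightarrow> \<sigma>\<close> have, by \<open>L2\<close>, a companion \<open>\<mu> \<rightarrow> \<sigma>' \<rightarrow> \<sigma>\<close> with
  \<open>\<sigma>' \<noteq> \<kappa>\<close>. As \<open>f \<sigma>' \<le> f \<mu> \<le> f \<kappa> < f \<sigma>\<close>, both \<open>\<kappa>\<close> and \<open>\<sigma>'\<close> would be counted by \<open>U \<sigma>\<close>.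
\<close>

lemma pair_notin_up:
  assumes s: "\<sigma> \<in> cells K'" and less: "f \<rho> < f \<sigma>" and nz: "inc K \<rho> \<sigma> \<noteq> 0"
  shows "\<rho> \<notin> {\<mu>, \<kappa>}"
proof
  have sK: "\<sigma> \<in> cells K" "\<sigma> \<noteq> \<kappa>" using s by (auto simp: cancel_pair_simps)
  assume "\<rho> \<in> {\<mu>, \<kappa>}"
  then consider "\<rho> = \<mu>" | "\<rho> = \<kappa>" by auto
  then show False
  proof cases
    case 1
    with f_below_mu[OF sK] less nz show False by simp
  next
    case 2
    from nz 2 obtain \<sigma>' where \<sigma>': "\<sigma>' \<in> cells K" "\<sigma>' \<noteq> \<kappa>" "inc K \<mu> \<sigma>' \<noteq> 0" "inc K \<sigma>' \<sigma> \<noteq> 0"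
      using L2_other[OF mu sK(1) kappa inc_mu_kappa] by metis
    from f_below_mu[OF \<sigma>'(1-3)] f_mu_le_f_kappa less 2 have "f \<sigma>' < f \<sigma>" by simp
    with up_snc_unique[OF morse_bott sK(1) kappa _ _ \<sigma>'(1,4)] nz less 2 \<sigma>'(2) show False by simp
  qed
qed

text \<open>Dually, \<open>\<sigma> \<rightarrow> \<mu> \<rightarrow> \<kappa>\<close> has a companion, and \<open>D \<sigma>\<close> would count two cells.\<close>

lemma pair_notin_down:
  assumes s: "\<sigma> \<in> cells K'" and less: "f \<sigma> < f \<rho>" and nz: "inc K \<sigma> \<rho> \<noteq> 0"
  shows "\<rho> \<notin> {\<mu>, \<kappa>}"
proof
  have sK: "\<sigma> \<in> cells K" "\<sigma> \<noteq> \<mu>" using s by (auto simp: cancel_pair_simps)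
  assume "\<rho> \<in> {\<mu>, \<kappa>}"
  then consider "\<rho> = \<kappa>" | "\<rho> = \<mu>" by auto
  then show False
  proof cases
    case 1
    with f_above_kappa[OF sK] less nz show False by simp
  next
    case 2
    from nz 2 obtain \<sigma>' where \<sigma>': "\<sigma>' \<in> cells K" "\<sigma>' \<noteq> \<mu>" "inc K \<sigma> \<sigma>' \<noteq> 0" "inc K \<sigma>' \<kappa> \<noteq> 0"
      using L2_other[OF sK(1) kappa mu _ inc_mu_kappa] by metis
    from f_above_kappa[OF \<sigma>'(1,2,4)] f_mu_le_f_kappa less 2 have "f \<sigma> < f \<sigma>'" by simp
    with down_snc_unique[OF morse_bott sK(1) mu _ _ \<sigma>'(1,3)] nz less 2 \<sigma>'(2) show False by simp
  qed
qed

lemma up_snc_cancel_pair: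
  assumes "\<sigma> \<in> cells K'"
  shows "up_snc K' f \<sigma> = up_snc K f \<sigma>"
proof -
  have "{\<tau> \<in> cells K'. inc K' \<tau> \<sigma> \<noteq> 0 \<and> f \<sigma> > f \<tau>} = {\<tau> \<in> cells K. inc K \<tau> \<sigma> \<noteq> 0 \<and> f \<sigma> > f \<tau>}"
    using inc_cancel_pair_less[OF _ assms] pair_notin_up[OF assms]
    by (auto simp: cancel_pair_simps(1))
  then show ?thesis by (simp add: up_snc_def)
qed

lemma down_snc_cancel_pair:
  assumes "\<sigma> \<in> cells K'"
  shows "down_snc K' f \<sigma> = down_snc K f \<sigma>"
proof -
  have "{\<nu> \<in> cells K'. inc K' \<sigma> \<nu> \<noteq> 0 \<and> f \<sigma> < f \<nu>} = {\<nu> \<in> cells K. inc K \<sigma> \<nu> \<noteq> 0 \<and> f \<sigma> < f \<nu>}"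
    using inc_cancel_pair_less[OF assms] pair_notin_down[OF assms]
    by (auto simp: cancel_pair_simps(1))
  then show ?thesis by (simp add: down_snc_def)
qed

lemma discrete_morse_bott_cancel_pair: "discrete_morse_bott K' f"
  using morse_bott up_snc_cancel_pair down_snc_cancel_pair
  by (auto simp: discrete_morse_bott_def cancel_pair_simps(1))

lemma weakly_critical_cancel_pair:
  "weakly_critical K' f \<sigma> \<longleftrightarrow> weakly_critical K f \<sigma> \<and> \<sigma> \<notin> {\<mu>, \<kappa>}"
  using up_snc_cancel_pair[of \<sigma>] down_snc_cancel_pair[of \<sigma>]
  by (auto simp: weakly_critical_def cancel_pair_simps(1))

lemma lefschetz_complex_wc: "lefschetz_complex (wc_complex K f)"
  by (rule lefschetz_complex_wc_complex[OF morse_bott])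

text \<open>
  A nonzero correction term \<open>w \<tau> \<kappa> * w \<mu> \<sigma>\<close> forces \<open>f \<sigma> \<le> f \<mu> \<le> f \<kappa> \<le> f \<tau>\<close>. Between cells of equal
  value it can only occur if all four values agree, and then it is a correction term inside \<open>W(K)\<close>.
\<close>

lemma inc_wc_cancel_pair:
  assumes "\<tau> \<in> cells K'" "\<sigma> \<in> cells K'"
  shows "inc (wc_complex K' f) \<tau> \<sigma> =
    (if f \<mu> < f \<kappa> then inc (wc_complex K f) \<tau> \<sigma> else inc (cancel_pair (wc_complex K f) \<mu> \<kappa>) \<tau> \<sigma>)"
proof -
  have "inc K \<tau> \<kappa> = 0 \<or> inc K \<mu> \<sigma> = 0 \<or> (f \<sigma> \<le> f \<mu> \<and> f \<kappa> \<le> f \<tau>)"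
    using f_above_kappa[of \<tau>] f_below_mu[of \<sigma>] assms by (auto simp: cancel_pair_simps)
  then show ?thesis
    using f_mu_le_f_kappa by (auto simp: cancel_pair_simps wc_complex_simps)
qed

lemma rank_wc_cancel_pair_less:
  assumes less: "f \<mu> < f \<kappa>"
  shows "rank_homology (wc_complex K' f) k = rank_homology (wc_complex K f) k"
    and "rank_boundaries (wc_complex K' f) k = rank_boundaries (wc_complex K f) k"
proof -
  have "\<not> weakly_critical K f \<mu>" "\<not> weakly_critical K f \<kappa>"
    using less inc_mu_kappa mu kappa by (force simp: weakly_critical_iff)+
  then have wc: "weakly_critical K' f \<sigma> \<longleftrightarrow> weakly_critical K f \<sigma>" for \<sigma>
    by (auto simp: weakly_critical_cancel_pair)
  have sub: "\<sigma> \<in> cells K'" if "\<sigma> \<in> cells (wc_complex K f)" for \<sigma>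
    using that wc[of \<sigma>] by (simp add: wc_complex_simps(1) weakly_critical_def)
  have cells: "cells (wc_complex K' f) = cells (wc_complex K f)"
    by (simp add: wc_complex_simps wc)
  have cdim: "cdim (wc_complex K' f) \<sigma> = cdim (wc_complex K f) \<sigma>" for \<sigma>
    by (simp add: wc_complex_simps(2) cancel_pair_simps(2))
  have inc: "inc (wc_complex K' f) \<tau> \<sigma> = inc (wc_complex K f) \<tau> \<sigma>"
    if "\<tau> \<in> cells (wc_complex K f)" "\<sigma> \<in> cells (wc_complex K f)" for \<tau> \<sigma>
    using inc_wc_cancel_pair[OF sub sub] that less by simp
  show "rank_homology (wc_complex K' f) k = rank_homology (wc_complex K f) k"
    "rank_boundaries (wc_complex K' f) k = rank_boundaries (wc_complex K f) k"
    by (rule rank_cong[OF cells cdim inc]; assumption)+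
qed

lemma rank_wc_cancel_pair_eq:
  assumes eq: "f \<mu> = f \<kappa>"
  shows "rank_homology (wc_complex K' f) k = rank_homology (wc_complex K f) k"
    and "rank_boundaries (wc_complex K f) k
      = rank_boundaries (wc_complex K' f) k + (if k = int (cdim K \<kappa>) then 1 else 0)"
proof -
  let ?W = "wc_complex K f"
  interpret W: lefschetz_pair ?W \<mu> \<kappa>
    using cancellable eq inc_mu_kappa
    by (intro lefschetz_pair.intro lefschetz_complex_wc lefschetz_pair_axioms.intro)
      (auto simp: wc_complex_simps)
  have cells: "cells (wc_complex K' f) = cells (cancel_pair ?W \<mu> \<kappa>)"
    by (auto simp: wc_complex_simps(1) cancel_pair_simps(1) weakly_critical_cancel_pair)
  have sub: "\<sigma> \<in> cells K'" if "\<sigma> \<in> cells (cancel_pair ?W \<mu> \<kappa>)" for \<sigma>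
    using that by (auto simp: wc_complex_simps(1) cancel_pair_simps(1) weakly_critical_def)
  have cdim: "cdim (wc_complex K' f) \<sigma> = cdim (cancel_pair ?W \<mu> \<kappa>) \<sigma>" for \<sigma>
    by (simp add: wc_complex_simps(2) cancel_pair_simps(2))
  have inc: "inc (wc_complex K' f) \<tau> \<sigma> = inc (cancel_pair ?W \<mu> \<kappa>) \<tau> \<sigma>"
    if "\<tau> \<in> cells (cancel_pair ?W \<mu> \<kappa>)" "\<sigma> \<in> cells (cancel_pair ?W \<mu> \<kappa>)" for \<tau> \<sigma>
    using inc_wc_cancel_pair[OF sub sub] that eq by simp
  note rank_cong[OF cells cdim inc, where k = k]
  then show "rank_homology (wc_complex K' f) k = rank_homology ?W k"
    and "rank_boundaries ?W k
      = rank_boundaries (wc_complex K' f) k + (if k = int (cdim K \<kappa>) then 1 else 0)"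
    using W.rank_homology_cancel_pair[of k] W.rank_boundaries_cancel_pair[of k]
    by (simp_all add: wc_complex_simps(2))
qed

text \<open>
  If \<open>f \<mu> < f \<kappa>\<close>, then \<open>D \<mu> = 1\<close>, so the cell \<open>\<mu>\<close> is lost from the count. The cell \<open>\<kappa>\<close> is never
  counted: a \<open>\<nu>\<close> counted by \<open>D \<kappa>\<close> would have \<open>\<kappa>\<close> counted by \<open>U \<nu>\<close>, against \<open>pair_notin_up\<close>.
\<close>

lemma d_snc_cancel_pair:
  "d_snc K f k = d_snc K' f k + (if f \<mu> < f \<kappa> \<and> k = int (cdim K \<mu>) then 1 else 0)"
proof -
  let ?A = "{\<sigma> \<in> dim_cells K' k. down_snc K' f \<sigma> = 1}"
  let ?M = "if f \<mu> < f \<kappa> \<and> k = int (cdim K \<mu>) then {\<mu>} else {}"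
  have kappa0: "down_snc K f \<kappa> = 0"
  proof -
    have False if \<nu>: "\<nu> \<in> cells K" "inc K \<kappa> \<nu> \<noteq> 0" "f \<kappa> < f \<nu>" for \<nu>
    proof -
      have "\<nu> \<noteq> \<mu>" "\<nu> \<noteq> \<kappa>" using L1[OF kappa \<nu>(1,2)] cdim_mu by auto
      with \<nu> have "\<nu> \<in> cells K'" by (simp add: cancel_pair_simps)
      from pair_notin_up[OF this \<nu>(3,2)] show False by simp
    qed
    then have "{\<nu> \<in> cells K. inc K \<kappa> \<nu> \<noteq> 0 \<and> f \<kappa> < f \<nu>} = {}" by blast
    then show ?thesis by (simp only: down_snc_def card.empty)
  qed
  have mu1: "down_snc K f \<mu> = (if f \<mu> < f \<kappa> then 1 else 0)"
  proof (cases "f \<mu> < f \<kappa>")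
    case True
    then have "{\<nu> \<in> cells K. inc K \<mu> \<nu> \<noteq> 0 \<and> f \<mu> < f \<nu>} = {\<kappa>}"
      using f_below_mu kappa inc_mu_kappa by force
    then show ?thesis using True by (simp add: down_snc_def)
  next
    case False
    then show ?thesis using cancellable by (auto simp: weakly_critical_def)
  qed
  have "{\<sigma> \<in> dim_cells K k. down_snc K f \<sigma> = 1} = ?A \<union> ?M"
  proof (rule Set.set_eqI)
    fix \<sigma>
    consider "\<sigma> = \<mu>" | "\<sigma> = \<kappa>" | "\<sigma> \<noteq> \<mu>" "\<sigma> \<noteq> \<kappa>" by blast
    then show "\<sigma> \<in> {\<sigma> \<in> dim_cells K k. down_snc K f \<sigma> = 1} \<longleftrightarrow> \<sigma> \<in> ?A \<union> ?M"
    proof cases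
      case 1
      have "\<mu> \<in> dim_cells K k \<longleftrightarrow> k = int (cdim K \<mu>)" using mu by (auto simp: dim_cells_def)
      with 1 mu1 show ?thesis by (simp add: dim_cells_cancel_pair)
    next
      case 2
      with kappa0 mu_neq_kappa show ?thesis by (simp add: dim_cells_cancel_pair)
    next
      case 3
      then have "\<sigma> \<in> dim_cells K k \<Longrightarrow> \<sigma> \<in> cells K'"
        by (simp add: dim_cells_def cancel_pair_simps(1))
      with 3 down_snc_cancel_pair[of \<sigma>] show ?thesis by (auto simp: dim_cells_cancel_pair)
    qed
  qed
  moreover have "finite ?A" "?A \<inter> ?M = {}"
    using finite_dim_cells' by (auto simp: dim_cells_cancel_pair)
  ultimately show ?thesis by (simp add: d_snc_def card_Un_disjoint)
qed

lemma poincare_series_wc_cancel_pair: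
  "poincare_series (wc_complex K' f) = poincare_series (wc_complex K f)"
  using cancellable by (intro poincare_series_cong) (auto intro: rank_wc_cancel_pair_less rank_wc_cancel_pair_eq)

text \<open>
  The rank of the boundaries of \<open>K\<close> drops by one in degree \<open>dim \<kappa>\<close>. If \<open>f \<mu> < f \<kappa>\<close>, this is
  compensated by the drop of \<open>d_snc\<close>, which is in degree \<open>dim \<mu> = dim \<kappa> + 1\<close> and enters the series
  shifted by one; if \<open>f \<mu> = f \<kappa>\<close>, by the drop for the weakly critical complex.
\<close>

lemma remainder_series_cancel_pair: "remainder_series K f = remainder_series K' f"
proof -
  have "int (rank_boundaries K n) - int (d_snc K f (n + 1)) - int (rank_boundaries (wc_complex K f) n)
      = int (rank_boundaries K' n) - int (d_snc K' f (n + 1)) - int (rank_boundaries (wc_complex K' f) n)"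
    for n
    using cancellable
  proof
    assume "f \<mu> < f \<kappa>"
    then show ?thesis
      using rank_boundaries_cancel_pair[of n] d_snc_cancel_pair[of "n + 1"]
        rank_wc_cancel_pair_less(2)[of n] cdim_mu by simp
  next
    assume "weakly_critical K f \<mu> \<and> weakly_critical K f \<kappa> \<and> f \<mu> = f \<kappa>"
    then show ?thesis
      using rank_boundaries_cancel_pair[of n] d_snc_cancel_pair[of "n + 1"]
        rank_wc_cancel_pair_eq(2)[of n] by simp
  qed
  then show ?thesis by (simp add: remainder_series_def)
qed

end

theorem proposition5p7:
  fixes K :: "'a lefschetz" and f :: "'a \<Rightarrow> real" and \<mu> \<kappa> :: 'a
  assumes "lefschetz_complex K"
    and "discrete_morse_bott K f"
    and "\<mu> \<in> cells K" and "\<kappa> \<in> cells K"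
    and "inc K \<mu> \<kappa> \<noteq> 0"
    and "f \<mu> < f \<kappa> \<or> (weakly_critical K f \<mu> \<and> weakly_critical K f \<kappa> \<and> f \<mu> = f \<kappa>)"
  shows "discrete_morse_bott (cancel_pair K \<mu> \<kappa>) f \<and>
         poincare_series (cancel_pair K \<mu> \<kappa>) = poincare_series K \<and>
         poincare_series (wc_complex (cancel_pair K \<mu> \<kappa>) f) = poincare_series (wc_complex K f) \<and>
         remainder_series K f = remainder_series (cancel_pair K \<mu> \<kappa>) f"
proof -
  interpret morse_bott_pair K \<mu> \<kappa> f
    using assms by (simp add: morse_bott_pair_def morse_bott_pair_axioms_def lefschetz_pair_def
        lefschetz_pair_axioms_def)
  show ?thesis
    using discrete_morse_bott_cancel_pair poincare_series_cancel_pair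
      poincare_series_wc_cancel_pair remainder_series_cancel_pair by blast
qed

end
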